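(* Let $t\in(0,1)$ and $n\ge1$. For $0<x<1$, let $X_1,\ldots,X_n$ be independent with $X_i \sim G_{xt^{i-1}}$. Let $\lambda,\nu \in \mathrm{Sig}_n$ with $\lambda \prec_Q \nu$. Then $$\Pr(\iota(X_1,\ldots,X_n;\lambda) = \nu) = \frac{1-x}{1-t^nx} \prod_{j\in\mathbb{Z}:\, m_j(\lambda)=m_j(\nu)+1}(1-t^{m_j(\lambda)}) \prod_{i=1}^n (xt^{i-1})^{\nu_i-\lambda_i} = \frac{Q_{\nu/\lambda}(x)\,P_\nu(1,\ldots,t^{n-1})}{P_\lambda(1,\ldots,t^{n-1})\, \Pi_{(0,t)}(x;1,\ldots,t^{n-1})}.$$
   Context: Signatures. $\mathrm{Sig}_n$ is the set of weakly decreasing $n$-tuples of integers. $|\lambda|=\sum_i\lambda_i$, $m_j(\lambda)=\#\{i:\lambda_i=j\}$. For $\lambda,\nu\in\mathrm{Sig}_n$, $\lambda\prec_Q\nu$ means $\nu_i\ge\lambda_i$ for $1\le i\le n$ and $\lambda_i\ge\nu_{i+1}$ for $1\le i\le n-1$. The measure $G_x$ on $\mathbb{Z}_{\ge0}$ (for $0<x<1$): $G_x(\{0\})=\frac{1-x}{1-tx}$ and $G_x(\{\ell\})=\frac{1-x}{1-tx}(1-t)x^\ell$ for $\ell>0$. Insertion map $\iota:\mathbb{Z}_{\ge0}^n\times\mathrm{Sig}_n\to\mathrm{Sig}_n$. View $\lambda$ as positions of particles $1,\ldots,n$ on $\mathbb{Z}$, particle $j$ at $\lambda_j$, with impulse $a_j$.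 Particle $n$ moves right until it has moved $a_n$ steps or has reached particle $n-1$; in the latter case it stops and donates the remaining impulse $a_n-(\lambda_{n-1}-\lambda_n)$ to particle $n-1$, which then moves in the same manner with its total impulse, possibly donating to particle $n-2$, and so on. Explicitly, with $\lambda_0=\infty$, set $e_n=a_n$ and $e_{j-1}=a_{j-1}+\max(0,e_j-(\lambda_{j-1}-\lambda_j))$ for $2\le j\le n$; then $\iota(a_1,\ldots,a_n;\lambda)_j=\min(\lambda_{j-1},\lambda_j+e_j)$ for $1\le j\le n$. Hall-Littlewood polynomials (with parameter $t$): $$P_\lambda(x_1,\ldots,x_n)=\frac1{v_\lambda(t)}\sum_{\sigma\in S_n}\sigma\Big(x_1^{\lambda_1}\cdots x_n^{\lambda_n}\prod_{1\le i<j\le n}\frac{x_i-tx_j}{x_i-x_j}\Big),\qquad v_\lambda(t)=\prod_{i\in\mathbb{Z}}\prod_{\ell=1}^{m_i(\lambda)}\frac{1-t^\ell}{1-t},$$ where $\sigma$ permutes the variables, and the one-variable skew polynomial is $Q_{\nu/\lambda}(x)=x^{|\nu|-|\lambda|}\prod_{i\in\mathbb{Z}:\,m_i(\nu)=m_i(\lambda)+1}(1-t^{m_i(\nu)})$ for $\lambda\prec_Q\nu$. Cauchy kernel: $\Pi_{(0,t)}(x;y_1,\ldots,y_n)=\prod_{j=1}^n\frac{1-txy_j}{1-xy_j}$. *)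

theory Defs
  imports "HOL-Probability.Probability" "HOL-Combinatorics.Permutations"
begin

text \<open>
  Signatures of length n are represented as functions on the index set {1..n}, made
  extensional (value \<^const>\<open>undefined\<close> outside {1..n}) so that HOL equality of functions
  is equality of n-tuples.
\<close>

definition Sig :: "nat \<Rightarrow> (nat \<Rightarrow> int) set" where
  "Sig n = {lam \<in> {1..n} \<rightarrow>\<^sub>E UNIV. antimono_on {1..n} lam}"

definition sig_size :: "nat \<Rightarrow> (nat \<Rightarrow> int) \<Rightarrow> int" where
  "sig_size n lam = (\<Sum>i\<in>{1..n}. lam i)"

definition sig_mult :: "nat \<Rightarrow> (nat \<Rightarrow> int) \<Rightarrow> int \<Rightarrow> nat" where
  "sig_mult n lam j = card {i \<in> {1..n}. lam i = j}"

definition interlaceQ :: "nat \<Rightarrow> (nat \<Rightarrow> int) \<Rightarrow> (nat \<Rightarrow> int) \<Rightarrow> bool" where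
  "interlaceQ n lam nu \<longleftrightarrow>
     (\<forall>i\<in>{1..n}. lam i \<le> nu i) \<and> (\<forall>i\<in>{1..<n}. nu (Suc i) \<le> lam i)"

definition G_measure :: "real \<Rightarrow> real \<Rightarrow> nat measure" where
  "G_measure t x = density (count_space UNIV)
     (\<lambda>l. ennreal (if l = 0 then (1 - x) / (1 - t * x)
                   else (1 - x) / (1 - t * x) * (1 - t) * x ^ l))"

text \<open>
  \<open>impulse n a lam j\<close> is the total impulse $e_j$ of particle j: its own impulse plus whatever
  particle j + 1 donates to it.
\<close>

function impulse :: "nat \<Rightarrow> (nat \<Rightarrow> nat) \<Rightarrow> (nat \<Rightarrow> int) \<Rightarrow> nat \<Rightarrow> int" where
  "impulse n a lam j = int (a j) +
     (if j < n then max 0 (impulse n a lam (Suc j) - (lam j - lam (Suc j))) else 0)"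
  by pat_completeness auto
termination
  by (relation "Wellfounded.measure (\<lambda>(n, a, lam, j). n - j)") auto

declare impulse.simps [simp del]

text \<open>The case j = 1 below is the convention $\lambda_0 = \infty$.\<close>

definition insertion :: "nat \<Rightarrow> (nat \<Rightarrow> nat) \<Rightarrow> (nat \<Rightarrow> int) \<Rightarrow> (nat \<Rightarrow> int)" where
  "insertion n a lam = (\<lambda>j\<in>{1..n}.
     if j = 1 then lam j + impulse n a lam j
     else min (lam (j - 1)) (lam j + impulse n a lam j))"

text \<open>
  The product over all integers i is restricted to the values taken by \<open>lam\<close>; the other
  factors are empty products. (HOL's product over an infinite set is 1 by convention.)
\<close>

definition HL_v :: "nat \<Rightarrow> real \<Rightarrow> (nat \<Rightarrow> int) \<Rightarrow> real" where
  "HL_v n t lam = (\<Prod>i\<in>lam ` {1..n}. \<Prod>l\<in>{1..sig_mult n lam i}. (1 - t ^ l) / (1 - t))"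

text \<open>
  Value of the Hall--Littlewood Laurent polynomial $P_\lambda$ at the point \<open>(x 1, \<dots>, x n)\<close>,
  computed summand by summand from its symmetrization formula. This is the value of the
  Laurent polynomial whenever the coordinates are nonzero and pairwise distinct, as they are
  for $(1, t, \ldots, t^{n-1})$ with $0 < t < 1$; at points with equal coordinates the
  summands have a vanishing denominator and the definition is not meaningful.
\<close>

definition HL_P :: "nat \<Rightarrow> real \<Rightarrow> (nat \<Rightarrow> int) \<Rightarrow> (nat \<Rightarrow> real) \<Rightarrow> real" where
  "HL_P n t lam x = 1 / HL_v n t lam *
     (\<Sum>\<sigma> | \<sigma> permutes {1..n}.
        (\<Prod>i\<in>{1..n}. x (\<sigma> i) powi lam i) *
        (\<Prod>i\<in>{1..n}. \<Prod>j\<in>{i<..n}. (x (\<sigma> i) - t * x (\<sigma> j)) / (x (\<sigma> i) - x (\<sigma> j))))"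

text \<open>
  The one-variable skew polynomial $Q_{\nu/\lambda}(x)$, with the usual value 0 when
  $\lambda \prec_Q \nu$ fails.
\<close>

definition HL_Q_skew :: "nat \<Rightarrow> real \<Rightarrow> (nat \<Rightarrow> int) \<Rightarrow> (nat \<Rightarrow> int) \<Rightarrow> real \<Rightarrow> real" where
  "HL_Q_skew n t nu lam x = (if interlaceQ n lam nu then
     x powi (sig_size n nu - sig_size n lam) *
     (\<Prod>i | sig_mult n nu i = sig_mult n lam i + 1. 1 - t ^ sig_mult n nu i) else 0)"

definition cauchy_kernel :: "nat \<Rightarrow> real \<Rightarrow> real \<Rightarrow> (nat \<Rightarrow> real) \<Rightarrow> real" where
  "cauchy_kernel n t x y = (\<Prod>j\<in>{1..n}. (1 - t * x * y j) / (1 - x * y j))"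

end

theory Submission imports Defs begin

text \<open>
  Particles move in the order n, n - 1, \<dots>, 1, so the event that the insertion produces \<open>nu\<close>
  is decided one particle at a time, and it suffices to follow the law of the total impulse of
  particle j on the event that the particles j + 1, \<dots>, n have landed where \<open>nu\<close> prescribes.
  Write $u_j = x t^{j-1}$. Up to a constant, $G_{u}$ has generating function
  $(1 - t u z)/(1 - u z)$. The law to be followed always has, up to a constant, the form
  $(1 - s u_j z)/(1 - u_j z)$ for some s: since $u_{j+1} = t u_j$, adding the next independent
  impulse to such a law gives the telescoping product
  \[ \frac{1 - t u_j z}{1 - u_j z} \cdot \frac{1 - s t u_j z}{1 - t u_j z}
     = \frac{1 - s t u_j z}{1 - u_j z}. \]
  This is \<open>sum_weight_convolution\<close>, and it is the reason for the geometric progression of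
  parameters. When particle j + 1 stops short of particle j nothing is donated and s is
  reset to t; when the two start at the same site and everything is donated, s is multiplied by t; when
  particle j + 1 moves and catches up with particle j, the donation is an overshoot of a
  geometric tail, hence purely geometric, and s becomes 0. So s is an explicit function
  \<open>tail_defect\<close> of \<open>lam\<close> and \<open>nu\<close>, and \<open>prob_arrive\<close> expresses the probability as a product
  over the particles. A particle that moves contributes a factor 1 - s, where s is 0 if its old
  site is refilled and $t^m$, with m the size of the cluster it leaves, otherwise. Among
  the sites that are left, the refilled ones are those whose multiplicity does not drop, which gives the first formula
  (\<open>prob_insertion\<close>).

  For the second formula, at the point $(1, t, \dots, t^{n-1})$ only the identity permutation
  survives in the symmetrization defining $P_\lambda$: if $k+1$ precedes $k$ in a permutation,
  the numerator $t^{k} - t \cdot t^{k-1}$ occurs. Hence the ratio of the two polynomials is a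
  power of t times a ratio of the normalizations $v_\lambda$ and $v_\nu$. The sites left and
  the sites entered are equinumerous, so the powers of 1 - t in that ratio cancel, and it
  exchanges the product over the sites entered, which is the coefficient in $Q_{\nu/\lambda}$,
  for the product over the sites left (\<open>HL_v_ratio\<close>).
\<close>

section \<open>Geometric weights\<close>

text \<open>
  Coefficients of the power series $(1 - s u z)/(1 - u z)$. The case s = t is the unnormalized
  measure $G_u$, the case s = 0 the unnormalized geometric distribution.
\<close>
definition weight :: "real \<Rightarrow> real \<Rightarrow> nat \<Rightarrow> real" where
  "weight s u l = (if l = 0 then 1 else (1 - s) * u ^ l)"

lemma weight_0 [simp]: "weight s u 0 = 1"
  by (simp add: weight_def)

text \<open>
  Overshooting a positive threshold forgets the atom at 0 and leaves a geometric law.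
\<close>
lemma weight_memoryless: "0 < d \<Longrightarrow> weight s u (d + c) = weight s u d * weight 0 u c"
  by (simp add: weight_def power_add)

text \<open>
  In terms of generating functions the numerator $1 - t v z$ of the first factor cancels the
  denominator of the second one.
\<close>
lemma sum_weight_convolution:
  "(\<Sum>c\<le>l. weight t v (l - c) * weight s (t * v) c) = weight (t * s) v l"
proof (cases l)
  case (Suc k)
  have geometric: "(\<Sum>c\<in>{1..<Suc k}. (1 - t) * t ^ c) = t - t ^ Suc k"
    by (induction k) (auto simp: algebra_simps)
  have "(\<Sum>c\<le>l. weight t v (l - c) * weight s (t * v) c)
      = weight t v l + (\<Sum>c\<in>{1..<l}. weight t v (l - c) * weight s (t * v) c)
        + weight s (t * v) l"
  proof -
    have "{..l} = insert 0 (insert l {1..<l})" using Suc by auto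
    then show ?thesis using Suc by simp
  qed
  also have "(\<Sum>c\<in>{1..<l}. weight t v (l - c) * weight s (t * v) c)
      = (\<Sum>c\<in>{1..<l}. ((1 - s) * v ^ l) * ((1 - t) * t ^ c))"
  proof (rule sum.cong[OF refl])
    fix c assume "c \<in> {1..<l}"
    then have "v ^ l = v ^ (l - c) * v ^ c" "c \<noteq> 0" "l - c \<noteq> 0"
      by (auto simp flip: power_add)
    then show "weight t v (l - c) * weight s (t * v) c
        = ((1 - s) * v ^ l) * ((1 - t) * t ^ c)"
      by (simp add: weight_def power_mult_distrib)
  qed
  also have "\<dots> = ((1 - s) * v ^ l) * (t - t ^ l)"
    using geometric Suc by (simp flip: sum_distrib_left)
  finally show ?thesis
    using Suc by (simp add: weight_def algebra_simps power_mult_distrib)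
qed simp

lemma mult_power_less_1:
  fixes t x :: real
  assumes "0 < t" "t < 1" "0 < x" "x < 1"
  shows "x * t ^ k < 1"
proof -
  have "x * t ^ k \<le> x" using assms by (intro mult_left_le power_le_one) auto
  then show ?thesis using assms(4) by (rule le_less_trans)
qed

section \<open>Interlacing signatures\<close>

lemma card_inj_on_fibre:
  assumes "inj_on f A"
  shows "card {i \<in> A. f i = j} = of_bool (j \<in> f ` A)"
proof (cases "j \<in> f ` A")
  case True
  then obtain i where "i \<in> A" "j = f i" by auto
  then have "{i \<in> A. f i = j} = {i}" using assms by (auto dest: inj_onD)
  then show ?thesis using True by simp
next
  case False
  then have empty: "{i \<in> A. f i = j} = {}" by auto
  show ?thesis unfolding empty using False by simp
qed

locale interlacing_signatures =
  fixes n :: nat and lam nu :: "nat \<Rightarrow> int"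
  assumes lam_Sig: "lam \<in> Sig n" and nu_Sig: "nu \<in> Sig n"
    and interlace: "interlaceQ n lam nu"
begin

lemma lam_antimono: "1 \<le> i \<Longrightarrow> i \<le> k \<Longrightarrow> k \<le> n \<Longrightarrow> lam k \<le> lam i"
  using lam_Sig by (auto simp: Sig_def monotone_on_def)

lemma nu_antimono: "1 \<le> i \<Longrightarrow> i \<le> k \<Longrightarrow> k \<le> n \<Longrightarrow> nu k \<le> nu i"
  using nu_Sig by (auto simp: Sig_def monotone_on_def)

lemma lam_le_nu: "1 \<le> i \<Longrightarrow> i \<le> n \<Longrightarrow> lam i \<le> nu i"
  using interlace by (auto simp: interlaceQ_def)

lemma nu_le_lam:
  assumes "1 \<le> i" "i < k" "k \<le> n"
  shows "nu k \<le> lam i"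
proof -
  have "nu k \<le> nu (Suc i)" using assms by (intro nu_antimono) auto
  also have "\<dots> \<le> lam i" using assms interlace by (auto simp: interlaceQ_def)
  finally show ?thesis .
qed

definition moved :: "nat set" where
  "moved = {i \<in> {1..n}. lam i < nu i}"

lemma finite_moved [simp]: "finite moved"
  by (simp add: moved_def)

text \<open>
  Particles cannot overtake the old position of the next one, so from each cluster of \<open>lam\<close> only
  the particle of lowest index can leave, and likewise at most one particle enters a given site.
\<close>
lemma inj_on_lam_moved: "inj_on lam moved"
proof (rule linorder_inj_onI)
  fix i k assume "i < k" "i \<in> moved" "k \<in> moved"
  then show "lam i \<noteq> lam k" using nu_le_lam[of i k] by (auto simp: moved_def)
qed auto

lemma inj_on_nu_moved: "inj_on nu moved"
proof (rule linorder_inj_onI)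
  fix i k assume "i < k" "i \<in> moved" "k \<in> moved"
  then show "nu i \<noteq> nu k" using nu_le_lam[of i k] by (auto simp: moved_def)
qed auto

text \<open>
  Since at most one particle enters and at most one leaves any site, multiplicities change by at
  most one, and the sites where they do are the images of the moved particles.
\<close>
lemma sig_mult_balance:
  "sig_mult n lam j + of_bool (j \<in> nu ` moved) = sig_mult n nu j + of_bool (j \<in> lam ` moved)"
proof -
  let ?stay = "{i \<in> {1..n} - moved. lam i = j}"
  have split: "card {i \<in> {1..n}. f i = j} = card {i \<in> {1..n} - moved. f i = j} + of_bool (j \<in> f ` moved)"
    if "inj_on f moved" for f :: "nat \<Rightarrow> int"
  proof -
    have "{i \<in> {1..n}. f i = j} = {i \<in> {1..n} - moved. f i = j} \<union> {i \<in> moved. f i = j}"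
      by (auto simp: moved_def)
    moreover have "card ({i \<in> {1..n} - moved. f i = j} \<union> {i \<in> moved. f i = j})
        = card {i \<in> {1..n} - moved. f i = j} + card {i \<in> moved. f i = j}"
      by (rule card_Un_disjoint) auto
    ultimately show ?thesis using card_inj_on_fibre[OF that, of j] by simp
  qed
  have "{i \<in> {1..n} - moved. nu i = j} = ?stay"
    using lam_le_nu by (force simp: moved_def)
  then show ?thesis
    using split[OF inj_on_lam_moved] split[OF inj_on_nu_moved] by (simp add: sig_mult_def)
qed

lemma departures: "{j. sig_mult n lam j = sig_mult n nu j + 1} = lam ` moved - nu ` moved"
proof (intro set_eqI)
  fix j show "j \<in> {j. sig_mult n lam j = sig_mult n nu j + 1} \<longleftrightarrow> j \<in> lam ` moved - nu ` moved"
    using sig_mult_balance[of j] by (simp add: of_bool_def split: if_splits)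
qed

lemma arrivals: "{j. sig_mult n nu j = sig_mult n lam j + 1} = nu ` moved - lam ` moved"
proof (intro set_eqI)
  fix j show "j \<in> {j. sig_mult n nu j = sig_mult n lam j + 1} \<longleftrightarrow> j \<in> nu ` moved - lam ` moved"
    using sig_mult_balance[of j] by (simp add: of_bool_def split: if_splits)
qed

lemma card_departures_eq_arrivals:
  "card (lam ` moved - nu ` moved) = card (nu ` moved - lam ` moved)"
proof -
  have "card (lam ` moved) = card (nu ` moved)"
    by (simp add: card_image inj_on_lam_moved inj_on_nu_moved)
  moreover have "card (lam ` moved - nu ` moved) = card (lam ` moved) - card (lam ` moved \<inter> nu ` moved)"
    by (rule card_Diff_subset_Int) auto
  moreover have "card (nu ` moved - lam ` moved) = card (nu ` moved) - card (lam ` moved \<inter> nu ` moved)"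
    unfolding Int_commute[of "lam ` moved"] by (rule card_Diff_subset_Int) auto
  ultimately show ?thesis by simp
qed

section \<open>The parameter of the impulse law\<close>

text \<open>
  The first parameter of the weight that governs the total impulse of particle j, given that
  the particles j + 1, \<dots>, n landed at \<open>nu\<close>. This closed form satisfies the recursion described
  in the introduction, which the next four lemmas record, and it relates directly to the
  multiplicities of \<open>lam\<close> and \<open>nu\<close>.
\<close>
definition tail_defect :: "real \<Rightarrow> nat \<Rightarrow> real" where
  "tail_defect t j = (if \<exists>i\<in>moved. j < i \<and> nu i = lam j then 0
                   else t ^ card {i \<in> {j..n}. lam i = lam j})"

lemma tail_defect_last: "1 \<le> n \<Longrightarrow> tail_defect t n = t"
proof -
  assume "1 \<le> n"
  have "{i \<in> {n..n}. lam i = lam n} = {n}" by auto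
  moreover have "\<not> (\<exists>i\<in>moved. n < i \<and> nu i = lam n)" by (auto simp: moved_def)
  ultimately show ?thesis by (simp only: tail_defect_def) simp
qed

lemma tail_defect_short:
  assumes "1 \<le> j" "j < n" "nu (Suc j) < lam j"
  shows "tail_defect t j = t"
proof -
  have lt: "nu i < lam j" "lam i < lam j" if "j < i" "i \<le> n" for i
    using nu_antimono[of "Suc j" i] lam_le_nu[of i] that assms by auto
  have "{i \<in> {j..n}. lam i = lam j} = {j}" using lt assms by (force simp: le_less)
  moreover have "\<not> (\<exists>i\<in>moved. j < i \<and> nu i = lam j)" using lt by (force simp: moved_def)
  ultimately show ?thesis by (simp only: tail_defect_def) simp
qed

lemma tail_defect_same_site:
  assumes "1 \<le> j" "j < n" "lam (Suc j) = lam j"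
  shows "tail_defect t j = t * tail_defect t (Suc j)"
proof -
  have "{i \<in> {j..n}. lam i = lam j} = insert j {i \<in> {Suc j..n}. lam i = lam (Suc j)}"
    using assms by (auto simp: le_less)
  then have "card {i \<in> {j..n}. lam i = lam j} = Suc (card {i \<in> {Suc j..n}. lam i = lam (Suc j)})"
    by simp
  moreover have "(\<exists>i\<in>moved. j < i \<and> nu i = lam j) \<longleftrightarrow> (\<exists>i\<in>moved. Suc j < i \<and> nu i = lam (Suc j))"
  proof -
    have "Suc j \<noteq> i" if "i \<in> moved" "nu i = lam j" for i
      using that assms by (auto simp: moved_def)
    then show ?thesis using assms(3) by (metis Suc_lessD Suc_lessI)
  qed
  ultimately show ?thesis
    by (cases "\<exists>i\<in>moved. Suc j < i \<and> nu i = lam (Suc j)") (simp_all only: tail_defect_def, simp_all)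
qed

lemma tail_defect_caught:
  assumes "1 \<le> j" "j < n" "nu (Suc j) = lam j" "lam (Suc j) < lam j"
  shows "tail_defect t j = 0"
proof -
  have "Suc j \<in> moved" using assms by (auto simp: moved_def)
  then show ?thesis using assms by (auto simp: tail_defect_def)
qed

text \<open>
  A moving particle has the lowest index in its cluster, so the particles of index at least j at
  its old site make up the whole cluster; and only particles of larger index can refill that site.
\<close>
lemma tail_defect_moved:
  assumes "j \<in> moved"
  shows "tail_defect t j = (if lam j \<in> nu ` moved then 0 else t ^ sig_mult n lam (lam j))"
proof -
  have j: "1 \<le> j" "j \<le> n" "lam j < nu j" using assms by (auto simp: moved_def)
  have "i \<ge> j" if "i \<in> {1..n}" "lam i = lam j" for i
    using nu_le_lam[of i j] that j by force
  then have "{i \<in> {1..n}. lam i = lam j} = {i \<in> {j..n}. lam i = lam j}"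
    using j by auto
  moreover have "(\<exists>i\<in>moved. j < i \<and> nu i = lam j) \<longleftrightarrow> lam j \<in> nu ` moved"
  proof
    assume "lam j \<in> nu ` moved"
    then obtain i where i: "i \<in> moved" "nu i = lam j" by auto
    then have "j < i" using nu_antimono[of i j] j by (force simp: moved_def not_le)
    then show "\<exists>i\<in>moved. j < i \<and> nu i = lam j" using i by auto
  qed force
  ultimately show ?thesis by (simp add: tail_defect_def sig_mult_def)
qed

text \<open>
  Only moved particles contribute a factor besides the power of u, and by \<open>tail_defect_moved\<close>
  that factor is 1 unless the old site is not refilled.
\<close>
lemma prod_weight_tail_defect:
  "(\<Prod>i\<in>{1..n}. weight (tail_defect t i) (u i) (nat (nu i - lam i)))
   = (\<Prod>j\<in>lam ` moved - nu ` moved. 1 - t ^ sig_mult n lam j)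
     * (\<Prod>i\<in>{1..n}. u i powi (nu i - lam i))"
proof -
  have "(\<Prod>i\<in>{1..n}. weight (tail_defect t i) (u i) (nat (nu i - lam i)))
      = (\<Prod>i\<in>{1..n}. (if i \<in> moved then 1 - tail_defect t i else 1) * (u i powi (nu i - lam i)))"
  proof (rule prod.cong[OF refl])
    fix i assume i: "i \<in> {1..n}"
    then have "lam i \<le> nu i" using lam_le_nu by auto
    then show "weight (tail_defect t i) (u i) (nat (nu i - lam i))
        = (if i \<in> moved then 1 - tail_defect t i else 1) * (u i powi (nu i - lam i))"
      using i by (auto simp: weight_def moved_def power_int_def)
  qed
  also have "\<dots> = (\<Prod>i\<in>{1..n}. if i \<in> moved then 1 - tail_defect t i else 1)
      * (\<Prod>i\<in>{1..n}. u i powi (nu i - lam i))"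
    by (rule prod.distrib)
  also have "(\<Prod>i\<in>{1..n}. if i \<in> moved then 1 - tail_defect t i else 1)
      = (\<Prod>i\<in>moved. 1 - tail_defect t i)"
    by (intro prod.mono_neutral_cong_right) (auto simp: moved_def)
  also have "\<dots> = (\<Prod>i\<in>moved. if lam i \<in> nu ` moved then 1 else 1 - t ^ sig_mult n lam (lam i))"
    by (rule prod.cong[OF refl]) (simp add: tail_defect_moved)
  also have "\<dots> = (\<Prod>j\<in>lam ` moved. if j \<in> nu ` moved then 1 else 1 - t ^ sig_mult n lam j)"
    by (simp add: prod.reindex[OF inj_on_lam_moved])
  also have "\<dots> = (\<Prod>j\<in>lam ` moved - nu ` moved. 1 - t ^ sig_mult n lam j)"
    by (intro prod.mono_neutral_cong_right) auto
  finally show ?thesis .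
qed

section \<open>Distribution of the insertion\<close>

text \<open>
  The displacement of particle i is its impulse truncated at the gap in front of it. Only the
  particles j + 1, \<dots>, n are constrained, all of which have a particle in front when j is at
  least 1.
\<close>
definition lands :: "(nat \<Rightarrow> nat) \<Rightarrow> nat \<Rightarrow> bool" where
  "lands a j \<longleftrightarrow> (\<forall>i\<in>{j<..n}. min (lam (i - 1) - lam i) (impulse n a lam i) = nu i - lam i)"

lemma insertion_eq_iff:
  assumes "1 \<le> n"
  shows "insertion n a lam = nu \<longleftrightarrow> impulse n a lam 1 = nu 1 - lam 1 \<and> lands a 1"
proof -
  have "insertion n a lam = nu \<longleftrightarrow> (\<forall>j\<in>{1..n}. insertion n a lam j = nu j)"
  proof
    assume *: "\<forall>j\<in>{1..n}. insertion n a lam j = nu j"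
    show "insertion n a lam = nu"
    proof (rule extensionalityI[of _ "{1..n}"])
      show "nu \<in> extensional {1..n}" using nu_Sig by (auto simp: Sig_def PiE_def)
    qed (use * in \<open>auto simp: insertion_def\<close>)
  qed auto
  also have "{1..n} = insert 1 {1<..n}" using assms by auto
  also have "(\<forall>j\<in>insert 1 {1<..n}. insertion n a lam j = nu j) \<longleftrightarrow>
      impulse n a lam 1 = nu 1 - lam 1 \<and> lands a 1"
    using assms by (auto simp: insertion_def lands_def min_def)
  finally show ?thesis .
qed

lemma impulse_nonneg: "0 \<le> impulse n a lam j"
  by (subst impulse.simps) auto

lemma impulse_cong:
  assumes "\<And>i. j \<le> i \<Longrightarrow> i \<le> n \<Longrightarrow> a i = b i" "j \<le> n"
  shows "impulse n a lam j = impulse n b lam j"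
  using assms(2,1)
proof (induction rule: inc_induct)
  case base
  then show ?case by (simp add: impulse.simps)
next
  case (step j)
  then have "impulse n a lam (Suc j) = impulse n b lam (Suc j)" by simp
  then show ?case using step by (simp add: impulse.simps[of n _ lam j])
qed

lemma lands_Suc:
  assumes "j < n"
  shows "lands a j \<longleftrightarrow> min (lam j - lam (Suc j)) (impulse n a lam (Suc j)) = nu (Suc j) - lam (Suc j)
     \<and> lands a (Suc j)"
proof -
  have "{j<..n} = insert (Suc j) {Suc j<..n}" using assms by auto
  then show ?thesis by (simp add: lands_def)
qed

text \<open>
  Here c is the impulse donated by particle j + 1. Whether it stops short of particle j, so that
  c is 0, or exactly fills the gap, its own total impulse is its displacement plus c.
\<close>
lemma impulse_lands_step:
  assumes "1 \<le> j" "j < n"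
  shows "impulse n a lam j = int l \<and> lands a j \<longleftrightarrow>
    (\<exists>c\<in>(if nu (Suc j) < lam j then {0} else {..l}). a j = l - c \<and>
       impulse n a lam (Suc j) = int (nat (nu (Suc j) - lam (Suc j)) + c) \<and> lands a (Suc j))"
proof -
  define g where "g = lam j - lam (Suc j)"
  define d where "d = nu (Suc j) - lam (Suc j)"
  define e where "e = impulse n a lam (Suc j)"
  have d: "0 \<le> d" "d \<le> g" "0 \<le> e"
    using assms lam_le_nu[of "Suc j"] nu_le_lam[of j "Suc j"] impulse_nonneg
    by (auto simp: d_def g_def e_def)
  have imp: "impulse n a lam j = int (a j) + max 0 (e - g)"
    using assms by (simp add: impulse.simps[of n a lam j] e_def g_def)
  have short: "nu (Suc j) < lam j \<longleftrightarrow> d < g" by (auto simp: d_def g_def)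
  have "int (a j) + max 0 (e - g) = int l \<and> min g e = d \<longleftrightarrow>
    (\<exists>c\<in>(if d < g then {0} else {..l}). a j = l - c \<and> e = int (nat d + c))"
  proof (cases "d < g")
    case True
    then show ?thesis using d by (auto simp: min_def max_def)
  next
    case False
    then have "g = d" using d by simp
    show ?thesis
    proof
      assume "int (a j) + max 0 (e - g) = int l \<and> min g e = d"
      then have "a j = l - nat (e - d) \<and> e = int (nat d + nat (e - d)) \<and> nat (e - d) \<le> l"
        using d \<open>g = d\<close> by (auto simp: min_def max_def split: if_splits)
      then show "\<exists>c\<in>(if d < g then {0} else {..l}). a j = l - c \<and> e = int (nat d + c)"
        using False by auto
    qed (use False d \<open>g = d\<close> in auto)
  qed
  then show ?thesis
    unfolding lands_Suc[OF assms(2)] imp short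
    unfolding g_def[symmetric] d_def[symmetric] e_def[symmetric] by blast
qed

text \<open>
  The effect of one particle on the impulse law. The factor split off is the contribution of the
  displacement of particle j + 1; what remains is the law for particle j with updated parameter.
\<close>
lemma sum_weight_step:
  fixes t u :: real
  assumes j: "1 \<le> j" "j < n"
  defines "d \<equiv> nat (nu (Suc j) - lam (Suc j))"
  shows "(\<Sum>c\<in>(if nu (Suc j) < lam j then {0} else {..l}).
            weight t u (l - c) * weight (tail_defect t (Suc j)) (t * u) (d + c))
       = weight (tail_defect t (Suc j)) (t * u) d * weight (tail_defect t j) u l"
proof (cases "nu (Suc j) < lam j")
  case True
  then show ?thesis using tail_defect_short[OF j] by simp
next
  case False
  then have full: "nu (Suc j) = lam j" using nu_le_lam[of j "Suc j"] j by simp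
  show ?thesis
  proof (cases "lam (Suc j) = lam j")
    case True
    then have "d = 0" using full by (simp add: d_def)
    then show ?thesis
      using False sum_weight_convolution[where t = t and v = u] tail_defect_same_site[OF j True] by simp
  next
    case ne: False
    then have lt: "lam (Suc j) < lam j" using lam_antimono[of j "Suc j"] j by simp
    then have "0 < d" using full by (simp add: d_def)
    then have "(\<Sum>c\<le>l. weight t u (l - c) * weight (tail_defect t (Suc j)) (t * u) (d + c))
      = weight (tail_defect t (Suc j)) (t * u) d * (\<Sum>c\<le>l. weight t u (l - c) * weight 0 (t * u) c)"
      by (simp add: weight_memoryless sum_distrib_left mult_ac)
    then show ?thesis
      using False sum_weight_convolution[where t = t and v = u and s = 0] tail_defect_caught[OF j full lt] by simp
  qed
qed

end

locale random_insertion = interlacing_signatures n lam nu + prob_space M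
  for n lam nu and M :: "'a measure" +
  fixes X :: "nat \<Rightarrow> 'a \<Rightarrow> nat" and t x :: real
  assumes t: "0 < t" "t < 1" and x: "0 < x" "x < 1"
    and indep: "indep_vars (\<lambda>_. count_space UNIV) X {1..n}"
    and distr_X: "\<And>i. i \<in> {1..n} \<Longrightarrow>
      distr M (count_space UNIV) (X i) = G_measure t (x * t ^ (i - 1))"
begin

abbreviation param :: "nat \<Rightarrow> real" where
  "param i \<equiv> x * t ^ (i - 1)"

definition arrive :: "nat \<Rightarrow> nat \<Rightarrow> 'a set" where
  "arrive j l = {\<omega> \<in> space M. impulse n (\<lambda>i. X i \<omega>) lam j = int l \<and> lands (\<lambda>i. X i \<omega>) j}"

lemma X_measurable [measurable]: "i \<in> {1..n} \<Longrightarrow> X i \<in> M \<rightarrow>\<^sub>M count_space UNIV"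
  using indep by (auto simp: indep_vars_def)

lemma prob_X_eq:
  assumes "i \<in> {1..n}"
  shows "prob {\<omega> \<in> space M. X i \<omega> = l} = (1 - param i) / (1 - t * param i) * weight t (param i) l"
proof -
  have p: "0 < param i" "param i < 1"
    using t x mult_power_less_1[OF t x] by auto
  have "t * param i < 1" using mult_strict_mono[of t 1 "param i" 1] p t by simp
  then have nonneg: "0 \<le> (1 - param i) / (1 - t * param i) * weight t (param i) l"
    using p t by (auto simp: weight_def)
  have "emeasure M {\<omega> \<in> space M. X i \<omega> = l} = emeasure (distr M (count_space UNIV) (X i)) {l}"
    using assms by (subst emeasure_distr) (auto intro!: arg_cong[where f = "emeasure M"])
  also have "\<dots> = ennreal ((1 - param i) / (1 - t * param i) * weight t (param i) l)"
    unfolding distr_X[OF assms] G_measure_def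
    by (subst emeasure_density) (auto simp: weight_def nn_integral_indicator_singleton mult.assoc)
  finally show ?thesis using nonneg by (simp add: measure_def)
qed

text \<open>
  The event concerns only the impulses of the particles k, \<dots>, n, which makes it independent of
  the impulses of the particles in front.
\<close>
lemma arrive_depends_above:
  assumes "1 \<le> k" "k \<le> n"
  shows "arrive k l = (\<lambda>\<omega>. \<lambda>i\<in>{k..n}. X i \<omega>) -` 
     {a \<in> {k..n} \<rightarrow>\<^sub>E UNIV. impulse n a lam k = int l \<and> lands a k} \<inter> space M"
proof -
  have "impulse n (\<lambda>i\<in>{k..n}. X i \<omega>) lam j = impulse n (\<lambda>i. X i \<omega>) lam j" if "k \<le> j" "j \<le> n" for j \<omega>
    using that by (intro impulse_cong) auto
  then show ?thesis using assms by (auto simp: arrive_def lands_def)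
qed

lemma sets_arrive [measurable]:
  assumes "1 \<le> k" "k \<le> n"
  shows "arrive k l \<in> sets M"
proof -
  have "(\<lambda>\<omega>. \<lambda>i\<in>{k..n}. X i \<omega>) \<in> M \<rightarrow>\<^sub>M PiM {k..n} (\<lambda>_. count_space UNIV)"
    using assms by (intro measurable_restrict X_measurable) auto
  then show ?thesis unfolding arrive_depends_above[OF assms]
    by (rule measurable_sets) (simp add: count_space_PiM_finite)
qed

lemma prob_X_arrive:
  assumes j: "1 \<le> j" "j < n"
  shows "prob ({\<omega> \<in> space M. X j \<omega> = m} \<inter> arrive (Suc j) l)
       = prob {\<omega> \<in> space M. X j \<omega> = m} * prob (arrive (Suc j) l)"
proof -
  let ?N = "\<lambda>_ :: nat. count_space UNIV :: nat measure"
  let ?A = "{a \<in> {j} \<rightarrow>\<^sub>E UNIV. a j = m}"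
  let ?B = "{a \<in> {Suc j..n} \<rightarrow>\<^sub>E UNIV. impulse n a lam (Suc j) = int l \<and> lands a (Suc j)}"
  have ind: "indep_var (PiM {j} ?N) (\<lambda>\<omega>. \<lambda>i\<in>{j}. X i \<omega>) (PiM {Suc j..n} ?N) (\<lambda>\<omega>. \<lambda>i\<in>{Suc j..n}. X i \<omega>)"
    by (rule indep_var_restrict[OF indep]) (use j in auto)
  have X: "{\<omega> \<in> space M. X j \<omega> = m} = (\<lambda>\<omega>. \<lambda>i\<in>{j}. X i \<omega>) -` ?A \<inter> space M"
    by auto
  have Y: "arrive (Suc j) l = (\<lambda>\<omega>. \<lambda>i\<in>{Suc j..n}. X i \<omega>) -` ?B \<inter> space M"
    using j by (intro arrive_depends_above) auto
  have "prob ((\<lambda>\<omega>. (\<lambda>i\<in>{j}. X i \<omega>, \<lambda>i\<in>{Suc j..n}. X i \<omega>)) -` (?A \<times> ?B) \<inter> space M)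
      = prob ((\<lambda>\<omega>. \<lambda>i\<in>{j}. X i \<omega>) -` ?A \<inter> space M)
        * prob ((\<lambda>\<omega>. \<lambda>i\<in>{Suc j..n}. X i \<omega>) -` ?B \<inter> space M)"
    by (rule indep_varD[OF ind]) (auto simp: count_space_PiM_finite)
  moreover have "(\<lambda>\<omega>. (\<lambda>i\<in>{j}. X i \<omega>, \<lambda>i\<in>{Suc j..n}. X i \<omega>)) -` (?A \<times> ?B) \<inter> space M
      = {\<omega> \<in> space M. X j \<omega> = m} \<inter> arrive (Suc j) l"
    unfolding X Y by blast
  ultimately show ?thesis unfolding X[symmetric] Y[symmetric] by simp
qed

text \<open>
  Downward induction on j: \<open>impulse_lands_step\<close> splits the event according to the donated impulse,
  independence turns each part into a product, and \<open>sum_weight_step\<close> sums the products.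
\<close>
lemma prob_arrive:
  assumes "1 \<le> j" "j \<le> n"
  shows "prob (arrive j l) = (\<Prod>i\<in>{j..n}. (1 - param i) / (1 - t * param i)) *
     (\<Prod>i\<in>{j<..n}. weight (tail_defect t i) (param i) (nat (nu i - lam i))) *
     weight (tail_defect t j) (param j) l"
  using assms(2,1)
proof (induction arbitrary: l rule: inc_induct)
  case base
  have "arrive n l = {\<omega> \<in> space M. X n \<omega> = l}"
    by (auto simp: arrive_def lands_def impulse.simps[of n _ lam n])
  then show ?case using base prob_X_eq[of n l] by (simp add: tail_defect_last)
next
  case (step j)
  have j: "1 \<le> j" "j < n" using step.hyps step.prems by auto
  define C where "C = (if nu (Suc j) < lam j then {0} else {..l})"
  define d where "d = nat (nu (Suc j) - lam (Suc j))"
  define W where "W = (\<Prod>i\<in>{Suc j..n}. (1 - param i) / (1 - t * param i)) *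
     (\<Prod>i\<in>{Suc j<..n}. weight (tail_defect t i) (param i) (nat (nu i - lam i)))"
  define q where "q = (1 - param j) / (1 - t * param j)"
  have param_Suc: "param (Suc j) = t * param j"
    using j by (cases j) auto
  have IH: "prob (arrive (Suc j) m) = W * weight (tail_defect t (Suc j)) (t * param j) m" for m
    using step.IH[of m, OF le_SucI[OF j(1)]] unfolding W_def param_Suc .
  have decomposition: "arrive j l = (\<Union>c\<in>C. {\<omega> \<in> space M. X j \<omega> = l - c} \<inter> arrive (Suc j) (d + c))"
  proof (rule set_eqI)
    fix \<omega>
    show "\<omega> \<in> arrive j l \<longleftrightarrow>
      \<omega> \<in> (\<Union>c\<in>C. {\<omega> \<in> space M. X j \<omega> = l - c} \<inter> arrive (Suc j) (d + c))"
      unfolding arrive_def mem_Collect_eq impulse_lands_step[OF j] C_def[symmetric] d_def[symmetric]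
      by auto
  qed
  have "prob (arrive j l) = (\<Sum>c\<in>C. prob ({\<omega> \<in> space M. X j \<omega> = l - c} \<inter> arrive (Suc j) (d + c)))"
    unfolding decomposition
  proof (rule finite_measure_finite_Union)
    show "disjoint_family_on (\<lambda>c. {\<omega> \<in> space M. X j \<omega> = l - c} \<inter> arrive (Suc j) (d + c)) C"
      by (auto simp: disjoint_family_on_def arrive_def)
    show "(\<lambda>c. {\<omega> \<in> space M. X j \<omega> = l - c} \<inter> arrive (Suc j) (d + c)) ` C \<subseteq> sets M"
    proof -
      have "{\<omega> \<in> space M. X j \<omega> = m} \<in> sets M" for m
      proof -
        have "{\<omega> \<in> space M. X j \<omega> = m} = X j -` {m} \<inter> space M" by auto
        then show ?thesis using measurable_sets[OF X_measurable[of j], of "{m}"] j by simp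
      qed
      then show ?thesis using sets_arrive[of "Suc j"] j by auto
    qed
  qed (simp add: C_def)
  also have "\<dots> = (\<Sum>c\<in>C. q * W *
      (weight t (param j) (l - c) * weight (tail_defect t (Suc j)) (t * param j) (d + c)))"
  proof (rule sum.cong[OF refl])
    fix c
    have "prob {\<omega> \<in> space M. X j \<omega> = l - c} = q * weight t (param j) (l - c)"
      unfolding q_def using j by (intro prob_X_eq) auto
    then show "prob ({\<omega> \<in> space M. X j \<omega> = l - c} \<inter> arrive (Suc j) (d + c)) = q * W *
      (weight t (param j) (l - c) * weight (tail_defect t (Suc j)) (t * param j) (d + c))"
      unfolding prob_X_arrive[OF j] IH by simp
  qed
  also have "\<dots> = q * W *
      (weight (tail_defect t (Suc j)) (t * param j) d * weight (tail_defect t j) (param j) l)"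
    unfolding sum_distrib_left[symmetric] C_def d_def sum_weight_step[OF j] ..
  also have "\<dots> = (\<Prod>i\<in>{j..n}. (1 - param i) / (1 - t * param i)) *
     (\<Prod>i\<in>{j<..n}. weight (tail_defect t i) (param i) (nat (nu i - lam i))) *
     weight (tail_defect t j) (param j) l"
  proof -
    have split: "{j..n} = insert j {Suc j..n}" "{j<..n} = insert (Suc j) {Suc j<..n}"
      using j by auto
    have "(\<Prod>i\<in>{j..n}. (1 - param i) / (1 - t * param i))
        = q * (\<Prod>i\<in>{Suc j..n}. (1 - param i) / (1 - t * param i))"
      unfolding split(1) q_def by (rule prod.insert) auto
    moreover have "(\<Prod>i\<in>{j<..n}. weight (tail_defect t i) (param i) (nat (nu i - lam i)))
        = weight (tail_defect t (Suc j)) (t * param j) d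
          * (\<Prod>i\<in>{Suc j<..n}. weight (tail_defect t i) (param i) (nat (nu i - lam i)))"
      unfolding split(2) d_def param_Suc[symmetric] by (rule prod.insert) auto
    moreover have "q * (a * b) * (c * d) = (q * a) * (c * b) * d" for a b c d
      by simp
    ultimately show ?thesis unfolding W_def by (simp only:)
  qed
  finally show ?case .
qed

text \<open>
  The parameters form a geometric progression of ratio t, so each denominator is the next
  numerator.
\<close>
lemma prod_telescope_normalizations:
  "(\<Prod>i\<in>{1..n}. (1 - param i) / (1 - t * param i)) = (1 - x) / (1 - t ^ n * x)"
proof -
  have ne: "1 - x * t ^ i \<noteq> 0" for i
    using mult_power_less_1[OF t x, of i] by simp
  have "(\<Prod>i\<in>{1..m}. (1 - param i) / (1 - t * param i)) = (1 - x) / (1 - t ^ m * x)" for m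
  proof (induction m)
    case 0
    then show ?case using x by simp
  next
    case (Suc m)
    then show ?case using ne[of m] ne[of "Suc m"] by (simp add: mult_ac)
  qed
  then show ?thesis .
qed

lemma prob_insertion:
  assumes "1 \<le> n"
  shows "prob {\<omega> \<in> space M. insertion n (\<lambda>i. X i \<omega>) lam = nu} =
    (1 - x) / (1 - t ^ n * x) *
    (\<Prod>j | sig_mult n lam j = sig_mult n nu j + 1. 1 - t ^ sig_mult n lam j) *
    (\<Prod>i\<in>{1..n}. param i powi (nu i - lam i))"
proof -
  let ?w = "\<lambda>i. weight (tail_defect t i) (param i) (nat (nu i - lam i))"
  have "{\<omega> \<in> space M. insertion n (\<lambda>i. X i \<omega>) lam = nu} = arrive 1 (nat (nu 1 - lam 1))"
    using lam_le_nu[of 1] assms by (simp add: arrive_def insertion_eq_iff)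
  then have "prob {\<omega> \<in> space M. insertion n (\<lambda>i. X i \<omega>) lam = nu}
      = (1 - x) / (1 - t ^ n * x) * ((\<Prod>i\<in>{1<..n}. ?w i) * ?w 1)"
    using prob_arrive[of 1 "nat (nu 1 - lam 1)"] assms
    unfolding prod_telescope_normalizations by simp
  also have "(\<Prod>i\<in>{1<..n}. ?w i) * ?w 1 = (\<Prod>i\<in>{1..n}. ?w i)"
  proof -
    have "{1..n} = insert 1 {1<..n}" using assms by auto
    then show ?thesis by (simp add: mult.commute)
  qed
  finally show ?thesis
    unfolding prod_weight_tail_defect departures by (simp add: mult.assoc)
qed

end

section \<open>Principal specialization of Hall--Littlewood polynomials\<close>

text \<open>
  The contribution of the identity permutation apart from the monomial. It is the same for all
  signatures of length n, so it cancels in ratios of Hall--Littlewood polynomials.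
\<close>
definition HL_const :: "nat \<Rightarrow> real \<Rightarrow> real" where
  "HL_const n t = (\<Prod>i\<in>{1..n}. \<Prod>j\<in>{i<..n}.
     (t ^ (i - 1) - t * t ^ (j - 1)) / (t ^ (i - 1) - t ^ (j - 1)))"

lemma permutes_no_descent_imp_id:
  assumes p: "p permutes {1..n::nat}" and no_descent: "\<And>k. 1 \<le> k \<Longrightarrow> k < n \<Longrightarrow> p k < p (Suc k)"
  shows "p = id"
proof (rule permutes_natset_ge[OF p], safe)
  fix i assume "i \<in> {1..n}"
  then have "1 \<le> i" "i \<le> n" by auto
  then show "i \<le> p i"
  proof (induction rule: dec_induct)
    case base
    then show ?case using permutes_in_image[OF p, of 1] by auto
  next
    case (step k)
    then show ?case using no_descent[of k] by simp
  qed
qed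

text \<open>
  A permutation other than the identity has some k + 1 occurring before k, and then a numerator
  $t^{k} - t \cdot t^{k-1}$ vanishes.
\<close>
lemma HL_P_principal_specialization:
  assumes t: "0 < t" "t < 1"
  shows "HL_P n t lam (\<lambda>i. t ^ (i - 1))
       = HL_const n t / HL_v n t lam * (\<Prod>i\<in>{1..n}. (t ^ (i - 1)) powi lam i)"
proof -
  define F where "F \<sigma> = (\<Prod>i\<in>{1..n}. (t ^ (\<sigma> i - 1)) powi lam i) *
    (\<Prod>i\<in>{1..n}. \<Prod>j\<in>{i<..n}.
       (t ^ (\<sigma> i - 1) - t * t ^ (\<sigma> j - 1)) / (t ^ (\<sigma> i - 1) - t ^ (\<sigma> j - 1)))" for \<sigma> :: "nat \<Rightarrow> nat"
  have vanish: "F \<sigma> = 0" if \<sigma>: "\<sigma> permutes {1..n}" and "\<sigma> \<noteq> id" for \<sigma>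
  proof -
    have "inv \<sigma> \<noteq> id" using that by (metis inv_id permutes_inv_inv)
    then obtain k where k: "1 \<le> k" "k < n" "inv \<sigma> (Suc k) \<le> inv \<sigma> k"
      using permutes_no_descent_imp_id[OF permutes_inv[OF \<sigma>]] by (meson not_less)
    define i j where "i = inv \<sigma> (Suc k)" and "j = inv \<sigma> k"
    have ij: "\<sigma> i = Suc k" "\<sigma> j = k" using permutes_inverses[OF \<sigma>] by (auto simp: i_def j_def)
    then have "i \<noteq> j" by auto
    have "i \<in> {1..n}" "j \<in> {1..n}"
      using permutes_in_image[OF permutes_inv[OF \<sigma>]] k by (auto simp: i_def j_def)
    then have "i \<in> {1..n}" "j \<in> {i<..n}" using k \<open>i \<noteq> j\<close> by (auto simp: i_def j_def)
    moreover have "t ^ (\<sigma> i - 1) - t * t ^ (\<sigma> j - 1) = 0"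
      using ij k(1) by (cases k) auto
    ultimately have "\<exists>i\<in>{1..n}. \<exists>j\<in>{i<..n}.
       (t ^ (\<sigma> i - 1) - t * t ^ (\<sigma> j - 1)) / (t ^ (\<sigma> i - 1) - t ^ (\<sigma> j - 1)) = 0"
      by (metis div_0)
    then show ?thesis by (simp only: F_def) (auto simp: prod_zero_iff)
  qed
  have "(\<Sum>\<sigma> | \<sigma> permutes {1..n}. F \<sigma>) = (\<Sum>\<sigma>\<in>{id}. F \<sigma>)"
    using vanish by (intro sum.mono_neutral_right) (auto simp: finite_permutations permutes_id)
  then have "(\<Sum>\<sigma> | \<sigma> permutes {1..n}. F \<sigma>)
      = (\<Prod>i\<in>{1..n}. (t ^ (i - 1)) powi lam i) * HL_const n t"
    by (simp add: F_def HL_const_def)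
  then show ?thesis unfolding HL_P_def F_def by simp
qed

lemma HL_const_nonzero:
  assumes t: "0 < t" "t < 1"
  shows "HL_const n t \<noteq> 0"
proof -
  have "t ^ (i - 1) - t * t ^ (j - 1) \<noteq> 0 \<and> t ^ (i - 1) - t ^ (j - 1) \<noteq> 0"
    if "i \<in> {1..n}" "j \<in> {i<..n}" for i j
  proof -
    have "t ^ j < t ^ (i - 1)" "t ^ (j - 1) < t ^ (i - 1)"
      using t that by (auto intro!: power_strict_decreasing)
    moreover have "t * t ^ (j - 1) = t ^ j" using that by (cases j) auto
    ultimately show ?thesis by auto
  qed
  then show ?thesis unfolding HL_const_def by (simp add: prod_zero_iff)
qed

lemma HL_v_nonzero:
  assumes t: "0 < t" "t < 1"
  shows "HL_v n t lam \<noteq> 0"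
proof -
  have "t ^ l < 1" if "l \<ge> 1" for l using t that by (simp add: power_less_one_iff)
  then show ?thesis using t unfolding HL_v_def by (force simp: prod_zero_iff)
qed

context interlacing_signatures
begin

text \<open>
  Where a site loses a particle, the quotient of the local factors of $v_\lambda$ and $v_\nu$ is
  $(1 - t^{m})/(1 - t)$ with m the larger multiplicity, and its inverse where a site gains one.
  The powers of 1 - t cancel because as many sites gain as lose.
\<close>
lemma HL_v_ratio:
  assumes t: "0 < t" "t < 1"
  shows "HL_v n t lam * (\<Prod>j\<in>nu ` moved - lam ` moved. 1 - t ^ sig_mult n nu j)
       = HL_v n t nu * (\<Prod>j\<in>lam ` moved - nu ` moved. 1 - t ^ sig_mult n lam j)"
proof -
  let ?A = "lam ` moved - nu ` moved" and ?B = "nu ` moved - lam ` moved"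
  define V where "V m = (\<Prod>l\<in>{1..m}. (1 - t ^ l) / (1 - t))" for m
  define T where "T = lam ` {1..n} \<union> nu ` {1..n}"
  have sub: "?A \<subseteq> T" "?B \<subseteq> T" and fin: "finite T" by (auto simp: T_def moved_def)
  have v: "HL_v n t f = (\<Prod>j\<in>T. V (sig_mult n f j))" if "f ` {1..n} \<subseteq> T" for f
  proof -
    have "sig_mult n f j = 0" if "j \<notin> f ` {1..n}" for j
      using that by (auto simp: sig_mult_def)
    then show ?thesis using that fin unfolding HL_v_def V_def[symmetric]
      by (intro prod.mono_neutral_left) (auto simp: V_def)
  qed
  \<comment> \<open>Products over the sites that change are compared site by site over the common index set T.\<close>
  have extend: "(\<Prod>j\<in>S. f j / (1 - t)) = (\<Prod>j\<in>T. if j \<in> S then f j / (1 - t) else 1)"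
    if "S \<subseteq> T" for S and f :: "int \<Rightarrow> real"
    using that fin by (intro prod.mono_neutral_cong_left) auto
  have V_Suc: "V (Suc m) = V m * ((1 - t ^ Suc m) / (1 - t))" for m
    by (simp add: V_def)
  have "HL_v n t lam * (\<Prod>j\<in>?B. (1 - t ^ sig_mult n nu j) / (1 - t))
      = HL_v n t nu * (\<Prod>j\<in>?A. (1 - t ^ sig_mult n lam j) / (1 - t))"
  proof -
    have "V (sig_mult n lam j) * (if j \<in> ?B then (1 - t ^ sig_mult n nu j) / (1 - t) else 1)
        = V (sig_mult n nu j) * (if j \<in> ?A then (1 - t ^ sig_mult n lam j) / (1 - t) else 1)" for j
      using sig_mult_balance[of j] V_Suc[of "sig_mult n lam j"] V_Suc[of "sig_mult n nu j"]
      by (cases "j \<in> lam ` moved"; cases "j \<in> nu ` moved") auto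
    moreover have "HL_v n t lam = (\<Prod>j\<in>T. V (sig_mult n lam j))"
      "HL_v n t nu = (\<Prod>j\<in>T. V (sig_mult n nu j))"
      by (intro v, simp add: T_def)+
    ultimately show ?thesis
      unfolding extend[OF sub(1)] extend[OF sub(2)] by (simp only: prod.distrib[symmetric])
  qed
  then show ?thesis
    using t card_departures_eq_arrivals by (simp add: prod_dividef)
qed

end

section \<open>The transition probability\<close>

lemma prod_powi_sum:
  fixes x :: "'b :: field"
  assumes "x \<noteq> 0"
  shows "(\<Prod>i\<in>A. x powi f i) = x powi (\<Sum>i\<in>A. f i)"
  by (induction A rule: infinite_finite_induct) (auto simp: power_int_add assms)

lemma cauchy_kernel_principal_specialization:
  assumes "0 < t" "t < 1" "0 < x" "x < 1"
  shows "cauchy_kernel n t x (\<lambda>i. t ^ (i - 1)) = (1 - t ^ n * x) / (1 - x)"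
proof (induction n)
  case 0
  then show ?case using assms by (simp add: cauchy_kernel_def)
next
  case (Suc n)
  have "1 - x * t ^ n \<noteq> 0" using mult_power_less_1[OF assms, of n] by simp
  then show ?case using Suc by (simp add: cauchy_kernel_def mult_ac)
qed

theorem proposition5p3:
  fixes M :: "'a measure" and X :: "nat \<Rightarrow> 'a \<Rightarrow> nat"
    and t x :: real and n :: nat and lam nu :: "nat \<Rightarrow> int"
  assumes "0 < t" "t < 1" and "n \<ge> 1" and "0 < x" "x < 1"
    and "prob_space M"
    and "prob_space.indep_vars M (\<lambda>_. count_space UNIV) X {1..n}"
    and "\<And>i. i \<in> {1..n} \<Longrightarrow> distr M (count_space UNIV) (X i) = G_measure t (x * t ^ (i - 1))"
    and "lam \<in> Sig n" and "nu \<in> Sig n" and "interlaceQ n lam nu"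
  shows "measure M {\<omega> \<in> space M. insertion n (\<lambda>i. X i \<omega>) lam = nu} =
           (1 - x) / (1 - t ^ n * x) *
           (\<Prod>j | sig_mult n lam j = sig_mult n nu j + 1. 1 - t ^ sig_mult n lam j) *
           (\<Prod>i\<in>{1..n}. (x * t ^ (i - 1)) powi (nu i - lam i))
         \<and> (1 - x) / (1 - t ^ n * x) *
           (\<Prod>j | sig_mult n lam j = sig_mult n nu j + 1. 1 - t ^ sig_mult n lam j) *
           (\<Prod>i\<in>{1..n}. (x * t ^ (i - 1)) powi (nu i - lam i)) =
         HL_Q_skew n t nu lam x * HL_P n t nu (\<lambda>i. t ^ (i - 1)) /
           (HL_P n t lam (\<lambda>i. t ^ (i - 1)) * cauchy_kernel n t x (\<lambda>i. t ^ (i - 1)))"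
proof -
  interpret prob_space M by fact
  interpret random_insertion n lam nu M X t x
    by unfold_locales (use assms in auto)
  define A where "A = (\<Prod>j\<in>lam ` moved - nu ` moved. 1 - t ^ sig_mult n lam j)"
  define B where "B = (\<Prod>j\<in>nu ` moved - lam ` moved. 1 - t ^ sig_mult n nu j)"
  define E where "E f = (\<Prod>i\<in>{1..n}. (t ^ (i - 1)) powi f i)" for f :: "nat \<Rightarrow> int"
  have powers: "(\<Prod>i\<in>{1..n}. (x * t ^ (i - 1)) powi (nu i - lam i))
      = x powi (sig_size n nu - sig_size n lam) * (E nu / E lam)"
  proof -
    have "(\<Prod>i\<in>{1..n}. (x * t ^ (i - 1)) powi (nu i - lam i))
        = (\<Prod>i\<in>{1..n}. x powi (nu i - lam i) * ((t ^ (i - 1)) powi nu i / (t ^ (i - 1)) powi lam i))"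
      using t by (intro prod.cong) (auto simp: power_int_mult_distrib power_int_diff)
    also have "\<dots> = x powi (\<Sum>i\<in>{1..n}. nu i - lam i) * (E nu / E lam)"
      using x by (simp only: prod.distrib prod_dividef E_def) (simp add: prod_powi_sum)
    finally show ?thesis by (simp add: sig_size_def sum_subtractf)
  qed
  have "HL_v n t lam * B = HL_v n t nu * A"
    unfolding A_def B_def by (rule HL_v_ratio[OF t])
  then have A: "A = HL_v n t lam * B / HL_v n t nu"
    using HL_v_nonzero[OF t] by (simp add: field_simps)
  have "(1 - x) / (1 - t ^ n * x) * A * (x powi (sig_size n nu - sig_size n lam) * (E nu / E lam))
      = x powi (sig_size n nu - sig_size n lam) * B * (HL_const n t / HL_v n t nu * E nu) /
        (HL_const n t / HL_v n t lam * E lam * ((1 - t ^ n * x) / (1 - x)))"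
    unfolding A using HL_v_nonzero[OF t, of n] HL_const_nonzero[OF t, of n] by (simp add: mult_ac)
  then have "(1 - x) / (1 - t ^ n * x) *
       (\<Prod>j | sig_mult n lam j = sig_mult n nu j + 1. 1 - t ^ sig_mult n lam j) *
       (\<Prod>i\<in>{1..n}. (x * t ^ (i - 1)) powi (nu i - lam i)) =
     HL_Q_skew n t nu lam x * HL_P n t nu (\<lambda>i. t ^ (i - 1)) /
       (HL_P n t lam (\<lambda>i. t ^ (i - 1)) * cauchy_kernel n t x (\<lambda>i. t ^ (i - 1)))"
    unfolding powers HL_P_principal_specialization[OF t] cauchy_kernel_principal_specialization[OF t x]
      HL_Q_skew_def departures arrivals A_def B_def E_def
    using interlace by simp
  then show ?thesis
    using prob_insertion[OF \<open>n \<ge> 1\<close>] by simp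
qed

end
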